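(* Let $R$ be a commutative ring, $n$ a positive integer, $X$ an $n\times n$ matrix over $R$, and $A$ any alternating $n\times n$ matrix over $R$. Then: (i) All entries of $\mathrm{adj}(X)\,A\,\mathrm{adj}(X)^{\mathrm T}$ are divisible by $\det(X)$. (ii) $\mathrm{adj}(X)\,A$ is right divisible by $X^{\mathrm T}$, and $A\,\mathrm{adj}(X)$ is left divisible by $X^{\mathrm T}$. (iii) (Buchweitz and Leuschke) If $A$ is invertible (so that $n$ is necessarily even), then $\mathrm{adj}(X)$ is right divisible by $X^{\mathrm T}A$ and left divisible by $A\,X^{\mathrm T}$.
   Context: $\mathrm{adj}(X)$ denotes the classical adjoint (adjugate) of $X$, i.e., the $n\times n$ matrix whose $(i,j)$ entry is $(-1)^{i+j}$ times the determinant of the matrix obtained from $X$ by deleting row $j$ and column $i$; it satisfies $X\,\mathrm{adj}(X)=\mathrm{adj}(X)\,X=\det(X)I_n$. $M^{\mathrm T}$ denotes the transpose of $M$. A square matrix $A$ is alternating if $A^{\mathrm T}=-A$ and all diagonal entries of $A$ are $0$. Divisibility of entries is in $R$. An $n\times n$ matrix $M$ over $R$ is right divisible by an $n\times n$ matrix $N$ over $R$ if $M=YN$ for some $n\times n$ matrix $Y$ over $R$, and left divisible by $N$ if $M=NY$ for some $n\times n$ matrix $Y$ over $R$. *)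

theory Defs
  imports Jordan_Normal_Form.Determinant
begin

definition alternating_mat :: "'a :: comm_ring_1 mat \<Rightarrow> bool" where
  "alternating_mat A \<longleftrightarrow>
     square_mat A \<and> transpose_mat A = - A \<and> (\<forall>i < dim_row A. A $$ (i, i) = 0)"

definition right_divisible_mat :: "nat \<Rightarrow> 'a :: comm_ring_1 mat \<Rightarrow> 'a mat \<Rightarrow> bool" where
  "right_divisible_mat n M N \<longleftrightarrow>
     M \<in> carrier_mat n n \<and> N \<in> carrier_mat n n \<and> (\<exists>Y \<in> carrier_mat n n. M = Y * N)"

definition left_divisible_mat :: "nat \<Rightarrow> 'a :: comm_ring_1 mat \<Rightarrow> 'a mat \<Rightarrow> bool" where
  "left_divisible_mat n M N \<longleftrightarrow>
     M \<in> carrier_mat n n \<and> N \<in> carrier_mat n n \<and> (\<exists>Y \<in> carrier_mat n n. M = N * Y)"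

end

theory Submission
  imports Defs
begin

text \<open>
  The heart of the matter is a factorisation \<open>adj(X) A = Y X\<^sup>T\<close>. Multiplied on the right
  by \<open>adj(X)\<^sup>T\<close>, this is Jacobi's theorem that the \<open>2 \<times> 2\<close> minors of \<open>adj(X)\<close> are divisible
  by \<open>det(X)\<close>: an alternating matrix is a combination, over pairs \<open>i < j\<close>, of the matrices
  \<open>E\<^sub>i\<^sub>j - E\<^sub>j\<^sub>i\<close>, and for such a matrix the entries of \<open>adj(X) A adj(X)\<^sup>T\<close> are exactly those minors.
  Deducing the factorisation from Jacobi's theorem would mean cancelling \<open>det(X)\<close>, which may be a
  zero divisor. Instead \<open>Y\<close> is written down: for \<open>A = E\<^sub>i\<^sub>j - E\<^sub>j\<^sub>i\<close> its entry at \<open>(k, l)\<close>, \<open>k \<noteq> l\<close>, is the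
  determinant of \<open>X\<close> with column \<open>k\<close> replaced by \<open>e\<^sub>i\<close> and column \<open>l\<close> by \<open>e\<^sub>j\<close>, and its diagonal is \<open>0\<close>. Replacing only column
  \<open>k\<close> gives a matrix \<open>Z\<close>, and \<open>Z adj(Z) = det(Z) I\<close>, read in row \<open>m\<close> and column \<open>j\<close>, is the required
  identity (\<open>sum_cofactor2_mult\<close>), valid over every commutative ring. Summing over \<open>i < j\<close> gives
  \<open>adj_mult_alternating_factor\<close>.

  Everything else follows formally. Multiplying \<open>adj(X) A = Y X\<^sup>T\<close> by \<open>adj(X)\<^sup>T\<close> on the right gives
  (i); applying it to \<open>X\<^sup>T\<close> and transposing gives the second half of (ii). If \<open>A\<close> is invertible,
  its inverse is again alternating (\<open>alternating_mat_inverse\<close>), so (iii) is (ii) for \<open>A\<^sup>-\<^sup>1\<close>, with the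
  factor \<open>A\<^sup>-\<^sup>1\<close> then moved to the other side. That \<open>n\<close> is even holds because an alternating matrix of
  odd size has determinant \<open>0\<close> (\<open>det_alternating_odd\<close>), in characteristic 2 as well.
\<close>

section \<open>Replacing one column by a unit vector\<close>

lemma cofactor_replace_col:
  assumes "X \<in> carrier_mat n n" and "i < n" and "k < n"
  shows "cofactor (replace_col X v k) i k = cofactor X i k"
proof -
  have "mat_delete (replace_col X v k) i k = mat_delete X i k"
    using assms by (intro eq_matI) (auto simp: mat_delete_def replace_col_def)
  then show ?thesis
    by (simp add: cofactor_def)
qed

lemma adj_mat_replace_col:
  assumes X: "X \<in> carrier_mat n n" and j: "j < n" and k: "k < n"
  shows "adj_mat (replace_col X v k) $$ (k, j) = adj_mat X $$ (k, j)"
  using assms cofactor_replace_col[OF X j k, of v]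
  by (simp add: adj_mat_def replace_col_def)

lemma det_replace_col_unit_vec:
  assumes X: "X \<in> carrier_mat n n" and i: "i < n" and k: "k < n"
  shows "det (replace_col X (unit_vec n i) k) = adj_mat X $$ (k, i)"
proof -
  let ?Z = "replace_col X (unit_vec n i) k"
  have Z: "?Z \<in> carrier_mat n n"
    using X by (simp add: replace_col_def)
  have "det ?Z = (\<Sum>r<n. ?Z $$ (r, k) * cofactor ?Z r k)"
    by (rule laplace_expansion_column[OF Z k])
  also have "\<dots> = (\<Sum>r<n. if r = i then cofactor X i k else 0)"
  proof (intro sum.cong refl)
    fix r assume "r \<in> {..<n}"
    then show "?Z $$ (r, k) * cofactor ?Z r k = (if r = i then cofactor X i k else 0)"
      using X i k cofactor_replace_col[OF X i k, of "unit_vec n i"]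
      by (simp add: replace_col_def)
  qed
  also have "\<dots> = cofactor X i k"
    using i by simp
  also have "\<dots> = adj_mat X $$ (k, i)"
    using X i k by (simp add: adj_mat_def)
  finally show ?thesis .
qed

section \<open>Factoring the product of the adjugate and an alternating matrix\<close>

text \<open>
  For \<open>l \<noteq> k\<close> this is the determinant of \<open>X\<close> with column \<open>k\<close> replaced by the unit vector \<open>e\<^sub>i\<close> and
  column \<open>l\<close> by \<open>e\<^sub>j\<close>, that is, up to sign, the complementary minor of Jacobi's theorem (which
  vanishes for \<open>i = j\<close>). Expressing it through the adjugate of the matrix with one column replaced
  makes the relation \<open>Z adj(Z) = det(Z) I\<close> applicable.
\<close>
definition cofactor2 :: "'a :: comm_ring_1 mat \<Rightarrow> nat \<Rightarrow> nat \<Rightarrow> nat \<Rightarrow> nat \<Rightarrow> 'a" where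
  "cofactor2 X i j k l =
     (if l = k then 0 else adj_mat (replace_col X (unit_vec (dim_row X) i) k) $$ (l, j))"

text \<open>
  With \<open>Z\<close> the matrix \<open>X\<close> whose column \<open>k\<close> is \<open>e\<^sub>i\<close>, the entry \<open>(m, j)\<close> of \<open>Z adj(Z)\<close> is
  \<open>\<delta>\<^sub>m\<^sub>j det(Z)\<close>, and \<open>det(Z)\<close> is the entry \<open>(k, i)\<close> of \<open>adj(X)\<close>. The sum below is that entry without its summand
  \<open>l = k\<close>, which is \<open>\<delta>\<^sub>m\<^sub>i\<close> times the entry \<open>(k, j)\<close> of \<open>adj(X)\<close>. The right-hand side is the entry
  \<open>(k, m)\<close> of \<open>adj(X) (E\<^sub>i\<^sub>j - E\<^sub>j\<^sub>i)\<close>.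
\<close>
lemma sum_cofactor2_mult:
  assumes X: "X \<in> carrier_mat n n" and ij: "i < n" "j < n" and km: "k < n" "m < n"
  shows "(\<Sum>l<n. cofactor2 X i j k l * X $$ (m, l)) =
     (if j = m then adj_mat X $$ (k, i) else 0) - (if i = m then adj_mat X $$ (k, j) else 0)"
proof -
  define Z where "Z = replace_col X (unit_vec n i) k"
  have Z: "Z \<in> carrier_mat n n"
    using X by (simp add: Z_def replace_col_def)
  have Z_entry: "Z $$ (m, l) = (if l = k then if i = m then 1 else 0 else X $$ (m, l))" if "l < n" for l
    using X that km ij by (auto simp: Z_def replace_col_def)
  have "(\<Sum>l<n. Z $$ (m, l) * adj_mat Z $$ (l, j)) = (Z * adj_mat Z) $$ (m, j)"
    using Z adj_mat(1)[OF Z] km ij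
    by (simp add: scalar_prod_def lessThan_atLeast0)
  also have "\<dots> = (if j = m then adj_mat X $$ (k, i) else 0)"
    using adj_mat(2)[OF Z] km ij det_replace_col_unit_vec[OF X ij(1) km(1)]
    by (simp add: Z_def)
  finally have full: "(\<Sum>l<n. Z $$ (m, l) * adj_mat Z $$ (l, j)) =
      (if j = m then adj_mat X $$ (k, i) else 0)" .
  have "(\<Sum>l<n. cofactor2 X i j k l * X $$ (m, l)) =
      (\<Sum>l<n. Z $$ (m, l) * adj_mat Z $$ (l, j)
         - (if l = k then (if i = m then adj_mat X $$ (k, j) else 0) else 0))"
    using X km ij adj_mat_replace_col[OF X ij(2) km(1), of "unit_vec n i"]
    by (intro sum.cong) (auto simp: cofactor2_def Z_entry Z_def[symmetric])
  also have "\<dots> = (if j = m then adj_mat X $$ (k, i) else 0)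
      - (if i = m then adj_mat X $$ (k, j) else 0)"
    using km by (simp add: sum_subtractf full)
  finally show ?thesis .
qed

lemma alternating_mat_skew:
  assumes "alternating_mat A" and "A \<in> carrier_mat n n" and "i < n" and "j < n"
  shows "A $$ (i, j) = - A $$ (j, i)"
proof -
  have "transpose_mat A $$ (j, i) = (- A) $$ (j, i)"
    using assms by (simp add: alternating_mat_def)
  then show ?thesis
    using assms by simp
qed

lemma alternating_mat_diag:
  assumes "alternating_mat A" and "A \<in> carrier_mat n n" and "i < n"
  shows "A $$ (i, i) = 0"
  using assms by (simp add: alternating_mat_def)

text \<open>
  Since \<open>A\<close> is the sum of \<open>a\<^sub>i\<^sub>j (E\<^sub>i\<^sub>j - E\<^sub>j\<^sub>i)\<close> over \<open>i < j\<close>, the factor for \<open>A\<close> is the corresponding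
  combination of the factors for the matrices \<open>E\<^sub>i\<^sub>j - E\<^sub>j\<^sub>i\<close>.
\<close>
lemma adj_mult_alternating_factor:
  assumes X: "X \<in> carrier_mat n n" and A: "A \<in> carrier_mat n n" and alt: "alternating_mat A"
  shows "\<exists>Y \<in> carrier_mat n n. adj_mat X * A = Y * transpose_mat X"
proof
  define Y where
    "Y = mat n n (\<lambda>(k, l). \<Sum>j<n. \<Sum>i<j. A $$ (i, j) * cofactor2 X i j k l)"
  show Y: "Y \<in> carrier_mat n n"
    by (simp add: Y_def)
  show "adj_mat X * A = Y * transpose_mat X"
  proof (rule eq_matI)
    fix k m assume "k < dim_row (Y * transpose_mat X)" "m < dim_col (Y * transpose_mat X)"
    then have k: "k < n" and m: "m < n"
      using X Y by auto
    let ?c = "\<lambda>i. adj_mat X $$ (k, i)"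
    have "(Y * transpose_mat X) $$ (k, m) =
        (\<Sum>l<n. (\<Sum>j<n. \<Sum>i<j. A $$ (i, j) * cofactor2 X i j k l) * X $$ (m, l))"
      using X k m by (simp add: Y_def scalar_prod_def lessThan_atLeast0)
    also have "\<dots> = (\<Sum>l<n. \<Sum>j<n. \<Sum>i<j. A $$ (i, j) * (cofactor2 X i j k l * X $$ (m, l)))"
      by (simp add: sum_distrib_right mult.assoc)
    also have "\<dots> = (\<Sum>j<n. \<Sum>l<n. \<Sum>i<j. A $$ (i, j) * (cofactor2 X i j k l * X $$ (m, l)))"
      by (rule sum.swap)
    also have "\<dots> = (\<Sum>j<n. \<Sum>i<j. \<Sum>l<n. A $$ (i, j) * (cofactor2 X i j k l * X $$ (m, l)))"
      by (intro sum.cong[OF refl] sum.swap)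
    also have "\<dots> = (\<Sum>j<n. \<Sum>i<j. A $$ (i, j) * (\<Sum>l<n. cofactor2 X i j k l * X $$ (m, l)))"
      by (simp add: sum_distrib_left)
    also have "\<dots> = (\<Sum>j<n. \<Sum>i<j. A $$ (i, j) * ((if j = m then ?c i else 0) - (if i = m then ?c j else 0)))"
      using X k m by (intro sum.cong refl) (simp add: sum_cofactor2_mult)
    also have "\<dots> = (\<Sum>j<n. (if j = m then \<Sum>i<m. A $$ (i, m) * ?c i else 0)
        - (if m < j then A $$ (m, j) * ?c j else 0))"
    proof (intro sum.cong refl)
      fix j
      have "(\<Sum>i<j. A $$ (i, j) * ((if j = m then ?c i else 0) - (if i = m then ?c j else 0))) =
         (\<Sum>i<j. (if j = m then A $$ (i, m) * ?c i else 0) - (if i = m then A $$ (m, j) * ?c j else 0))"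
        by (intro sum.cong) (auto simp: algebra_simps)
      then show "(\<Sum>i<j. A $$ (i, j) * ((if j = m then ?c i else 0) - (if i = m then ?c j else 0))) =
         (if j = m then \<Sum>i<m. A $$ (i, m) * ?c i else 0) - (if m < j then A $$ (m, j) * ?c j else 0)"
        by (simp add: sum_subtractf)
    qed
    \<comment> \<open>The pairs \<open>i < m\<close> give the part of column \<open>m\<close> of \<open>A\<close> above the diagonal; the pairs \<open>m < j\<close>
      give, by skew symmetry, the part below it.\<close>
    also have "\<dots> = (\<Sum>i<m. ?c i * A $$ (i, m)) + (\<Sum>j<n. if m < j then ?c j * A $$ (j, m) else 0)"
    proof -
      have "(\<Sum>j<n. if m < j then A $$ (m, j) * ?c j else 0) =
          - (\<Sum>j<n. if m < j then ?c j * A $$ (j, m) else 0)"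
        unfolding sum_negf[symmetric]
        using alternating_mat_skew[OF alt A m]
        by (intro sum.cong) (auto simp: mult.commute)
      then show ?thesis
        using m by (simp add: sum_subtractf mult.commute)
    qed
    also have "(\<Sum>i<m. ?c i * A $$ (i, m)) = (\<Sum>j<n. if j < m then ?c j * A $$ (j, m) else 0)"
      using m by (intro sum.mono_neutral_cong_left) auto
    also have "\<dots> + (\<Sum>j<n. if m < j then ?c j * A $$ (j, m) else 0) = (\<Sum>j<n. ?c j * A $$ (j, m))"
      unfolding sum.distrib[symmetric]
      using alternating_mat_diag[OF alt A m]
      by (intro sum.cong) auto
    also have "\<dots> = (adj_mat X * A) $$ (k, m)"
      using A adj_mat(1)[OF X] k m by (simp add: scalar_prod_def lessThan_atLeast0)
    finally show "(adj_mat X * A) $$ (k, m) = (Y * transpose_mat X) $$ (k, m)"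
      by simp
  qed (use X A Y adj_mat(1)[OF X] in auto)
qed

lemma adj_mat_transpose:
  assumes "X \<in> carrier_mat n n"
  shows "adj_mat (transpose_mat X) = transpose_mat (adj_mat X)"
proof (rule eq_matI)
  fix i j assume "i < dim_row (transpose_mat (adj_mat X))" "j < dim_col (transpose_mat (adj_mat X))"
  then have ij: "i < n" "j < n"
    using assms by (auto simp: adj_mat_def)
  have "mat_delete (transpose_mat X) j i = transpose_mat (mat_delete X i j)"
    using assms ij by (intro eq_matI) (auto simp: mat_delete_def)
  moreover have "det (transpose_mat (mat_delete X i j)) = det (mat_delete X i j)"
    by (rule det_transpose[OF mat_delete_carrier[OF assms]])
  ultimately show "adj_mat (transpose_mat X) $$ (i, j) = transpose_mat (adj_mat X) $$ (i, j)"
    using assms ij by (simp add: adj_mat_def cofactor_def add.commute)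
qed (use assms in \<open>auto simp: adj_mat_def\<close>)

text \<open>
  The transpose of the preceding factorisation, taken for \<open>X\<^sup>T\<close>; the sign from \<open>A\<^sup>T = - A\<close> is absorbed
  in the factor.
\<close>
lemma alternating_mult_adj_factor:
  assumes X: "X \<in> carrier_mat n n" and A: "A \<in> carrier_mat n n" and alt: "alternating_mat A"
  shows "\<exists>Y \<in> carrier_mat n n. A * adj_mat X = transpose_mat X * Y"
proof -
  have Xt: "transpose_mat X \<in> carrier_mat n n"
    using X by simp
  obtain Y where Y: "Y \<in> carrier_mat n n"
    and eq: "adj_mat (transpose_mat X) * A = Y * X"
    using adj_mult_alternating_factor[OF Xt A alt] by auto
  have "transpose_mat (adj_mat (transpose_mat X) * A) = transpose_mat (Y * X)"
    using eq by simp
  then have "- A * adj_mat X = transpose_mat X * transpose_mat Y"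
    using transpose_mult[OF adj_mat(1)[OF Xt] A] transpose_mult[OF Y X] alt
    by (simp add: adj_mat_transpose[OF X] alternating_mat_def)
  then have "A * adj_mat X = transpose_mat X * (- transpose_mat Y)"
    using A X Y adj_mat(1)[OF X]
    by (metis carrier_matD index_transpose_mat(2,3) uminus_mult_left_mat uminus_mult_right_mat uminus_uminus_mat)
  then show ?thesis
    using Y by (intro bexI[of _ "- transpose_mat Y"]) auto
qed

section \<open>Inverses of alternating matrices\<close>

text \<open>
  Exchanging the two indices only shows that twice the sum is \<open>0\<close>; pairing the summands \<open>(i, j)\<close> and
  \<open>(j, i)\<close> off the diagonal also covers characteristic 2.
\<close>
lemma sum_skew_symmetric_eq_0:
  fixes f :: "'b \<Rightarrow> 'b \<Rightarrow> 'a :: comm_ring_1"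
  assumes "finite S"
    and skew: "\<And>i j. i \<in> S \<Longrightarrow> j \<in> S \<Longrightarrow> f i j = - f j i"
    and diag: "\<And>i. i \<in> S \<Longrightarrow> f i i = 0"
  shows "(\<Sum>i\<in>S. \<Sum>j\<in>S. f i j) = 0"
proof -
  have "(\<Sum>i\<in>S. \<Sum>j\<in>S. f i j) = (\<Sum>(i, j)\<in>S \<times> S. f i j)"
    by (simp add: sum.cartesian_product)
  also have "\<dots> = (\<Sum>(i, j)\<in>{(i, j) \<in> S \<times> S. i \<noteq> j}. f i j)"
    using \<open>finite S\<close> diag by (intro sum.mono_neutral_right) auto
  also have "\<dots> = 0"
  proof (rule sum_involution_eq_0[where h = prod.swap])
    fix x assume "x \<in> {(i, j) \<in> S \<times> S. i \<noteq> j}"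
    then obtain i j where x: "x = (i, j)" and ij: "i \<in> S" "j \<in> S"
      by blast
    show "(case prod.swap x of (i, j) \<Rightarrow> f i j) + (case x of (i, j) \<Rightarrow> f i j) = 0"
      by (simp add: x skew[OF ij])
  qed auto
  finally show ?thesis .
qed

text \<open>
  The diagonal entries are the values of the quadratic form of \<open>A\<close> at the rows of \<open>P\<close>.
\<close>
lemma alternating_mat_congruence:
  assumes P: "P \<in> carrier_mat n n" and A: "A \<in> carrier_mat n n" and alt: "alternating_mat A"
  shows "alternating_mat (P * A * transpose_mat P)"
proof -
  have "transpose_mat (P * A * transpose_mat P) = P * (transpose_mat A * transpose_mat P)"
    using P A by (simp add: transpose_mult[of _ n n _ n])
  also have "\<dots> = - (P * A * transpose_mat P)"
    using P A alt assoc_mult_mat[OF P A, of "transpose_mat P" n]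
    by (simp add: alternating_mat_def)
  finally have skew: "transpose_mat (P * A * transpose_mat P) = - (P * A * transpose_mat P)" .
  have "(P * A * transpose_mat P) $$ (i, i) = 0" if i: "i < n" for i
  proof -
    have "(P * A * transpose_mat P) $$ (i, i) = (P * (A * transpose_mat P)) $$ (i, i)"
      using P A by (simp add: assoc_mult_mat[of _ n n _ n _ n])
    also have "\<dots> = (\<Sum>j<n. P $$ (i, j) * (\<Sum>k<n. A $$ (j, k) * P $$ (i, k)))"
      using P A i by (simp add: scalar_prod_def lessThan_atLeast0)
    also have "\<dots> = (\<Sum>j<n. \<Sum>k<n. P $$ (i, j) * A $$ (j, k) * P $$ (i, k))"
      by (simp add: sum_distrib_left mult.assoc)
    also have "\<dots> = 0"
    proof (rule sum_skew_symmetric_eq_0)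
      fix j k assume "j \<in> {..<n}" "k \<in> {..<n}"
      then have "A $$ (j, k) = - A $$ (k, j)"
        by (intro alternating_mat_skew[OF alt A]) auto
      then show "P $$ (i, j) * A $$ (j, k) * P $$ (i, k) = - (P $$ (i, k) * A $$ (k, j) * P $$ (i, j))"
        by (simp add: algebra_simps)
    qed (use alternating_mat_diag[OF alt A] in auto)
    finally show ?thesis .
  qed
  then show ?thesis
    using P A skew by (simp add: alternating_mat_def)
qed

text \<open>
  From \<open>A B = I\<close> one gets \<open>B\<^sup>T A B = B\<^sup>T\<close>, so \<open>B\<^sup>T\<close> is congruent to \<open>A\<close>, hence alternating.
\<close>
lemma alternating_mat_inverse:
  assumes A: "A \<in> carrier_mat n n" and B: "B \<in> carrier_mat n n" and alt: "alternating_mat A"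
    and AB: "A * B = 1\<^sub>m n"
  shows "alternating_mat B"
proof -
  let ?C = "transpose_mat B"
  have "?C * A * transpose_mat ?C = ?C * (A * B)"
    using A B by (simp add: assoc_mult_mat[of _ n n _ n _ n])
  also have "\<dots> = ?C"
    using AB B by simp
  finally have "alternating_mat ?C"
    using alternating_mat_congruence[of ?C n A] A B alt by simp
  then show ?thesis
    unfolding alternating_mat_def by (metis index_transpose_mat square_mat.elims(1) transpose_transpose transpose_uminus)
qed

section \<open>Alternating matrices of odd size\<close>

text \<open>
  The sign recording whether \<open>h\<close> moves a point up or down is reversed by \<open>h\<close>, so the signs sum to
  \<open>0\<close>; and each sign is congruent to \<open>1\<close> modulo 2.
\<close>
lemma even_card_of_fixpoint_free_involution:
  fixes h :: "'b :: linorder \<Rightarrow> 'b"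
  assumes h: "\<And>x. x \<in> S \<Longrightarrow> h x \<in> S" "\<And>x. x \<in> S \<Longrightarrow> h (h x) = x"
    "\<And>x. x \<in> S \<Longrightarrow> h x \<noteq> x"
  shows "even (card S)"
proof -
  let ?s = "\<lambda>x. if x < h x then 1 else - 1 :: int"
  have "sum ?s S = 0"
    using h by (intro sum_involution_eq_0[where h = h]) (auto simp: not_less)
  then have "int (card S) = (\<Sum>x\<in>S. 1 - ?s x)"
    by (simp add: sum_subtractf)
  moreover have "even (\<Sum>x\<in>S. 1 - ?s x)"
    by (intro dvd_sum) auto
  ultimately show ?thesis
    by presburger
qed

text \<open>
  In the Leibniz expansion, skew symmetry makes the terms of \<open>p\<close> and of its inverse differ by the
  factor \<open>(-1)\<^sup>n = -1\<close>, so they cancel whenever they belong to different permutations. If \<open>p\<close> is its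
  own inverse, it has a fixed point because \<open>n\<close> is odd, and its term contains a diagonal entry of \<open>A\<close>,
  which is \<open>0\<close>. Arguing only with \<open>det(A) = det(A\<^sup>T) = - det(A)\<close> would lose a factor 2.
\<close>
lemma det_alternating_odd:
  assumes A: "A \<in> carrier_mat n n" and alt: "alternating_mat A" and "odd n"
  shows "det A = 0"
proof -
  let ?inv = Hilbert_Choice.inv
  let ?P = "{p. p permutes {0..<n}}"
  let ?t = "\<lambda>p. signof p * (\<Prod>i = 0..<n. A $$ (i, p i)) :: 'a"
  let ?Q = "{p \<in> ?P. ?inv p \<noteq> p}"
  have inv_term: "?t (?inv p) = - ?t p" if p: "p permutes {0..<n}" for p
  proof -
    have "(\<Prod>i = 0..<n. A $$ (i, ?inv p i)) = (\<Prod>j = 0..<n. A $$ (p j, ?inv p (p j)))"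
      using permutes_imp_bij[OF p] by (rule prod.reindex_bij_betw[symmetric])
    also have "\<dots> = (\<Prod>j = 0..<n. - 1 * A $$ (j, p j))"
    proof (intro prod.cong refl)
      fix j assume "j \<in> {0..<n}"
      moreover from this have "p j \<in> {0..<n}"
        using permutes_in_image[OF p] by blast
      ultimately show "A $$ (p j, ?inv p (p j)) = - 1 * A $$ (j, p j)"
        using alternating_mat_skew[OF alt A, of "p j" j] permutes_inverses(2)[OF p] by simp
    qed
    also have "\<dots> = - (\<Prod>j = 0..<n. A $$ (j, p j))"
      unfolding prod.distrib using \<open>odd n\<close> by simp
    finally have prod_eq: "(\<Prod>i = 0..<n. A $$ (i, ?inv p i)) = - (\<Prod>j = 0..<n. A $$ (j, p j))" .
    have "permutation p"
      using p by (rule permutes_imp_permutation[rotated]) simp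
    then have "sign (?inv p) = sign p"
      by (rule sign_inverse)
    then show ?thesis
      by (simp only: prod_eq mult_minus_right)
  qed
  have fixed_term: "?t p = 0" if p: "p permutes {0..<n}" and "?inv p = p" for p
  proof -
    have "\<exists>i\<in>{0..<n}. p i = i"
    proof (rule ccontr)
      assume "\<not> ?thesis"
      then have "even (card {0..<n})"
        using permutes_in_image[OF p] permutes_inverses(1)[OF p] \<open>?inv p = p\<close>
        by (intro even_card_of_fixpoint_free_involution[where h = p]) auto
      with \<open>odd n\<close> show False
        by simp
    qed
    then obtain i where i: "i \<in> {0..<n}" "p i = i"
      by blast
    then have "A $$ (i, p i) = 0"
      using alternating_mat_diag[OF alt A] by simp
    with i(1) have "(\<Prod>i = 0..<n. A $$ (i, p i)) = 0"
      by (intro prod_zero) auto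
    then show ?thesis
      by simp
  qed
  have "det A = sum ?t ?P"
    by (rule det_def'[OF A])
  also have "\<dots> = sum ?t ?Q"
    using fixed_term by (intro sum.mono_neutral_right) (auto simp: finite_permutations)
  also have "\<dots> = 0"
  proof (rule sum_involution_eq_0[where h = ?inv])
    fix p assume p: "p \<in> ?Q"
    then show "?t (?inv p) + ?t p = 0"
      using inv_term by simp
    show inv_inv: "?inv (?inv p) = p"
      using p permutes_inv_inv by blast
    show "?inv p \<noteq> p"
      using p by blast
    then show "?inv p \<in> ?Q"
      using p inv_inv permutes_inv[of p "{0..<n}"] by auto
  qed
  finally show ?thesis .
qed

lemma invertible_alternating_even_dim:
  assumes A: "A \<in> carrier_mat n n" and B: "B \<in> carrier_mat n n" and alt: "alternating_mat A"
    and AB: "A * B = 1\<^sub>m n"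
  shows "even n"
proof (rule ccontr)
  assume "odd n"
  then have "det (A * B) = 0"
    using det_mult[OF A B] det_alternating_odd[OF A alt] by simp
  then show False
    using AB by simp
qed

theorem theorem7:
  fixes X A :: "'a :: comm_ring_1 mat" and n :: nat
  assumes "n > 0"
    and "X \<in> carrier_mat n n"
    and "A \<in> carrier_mat n n"
    and "alternating_mat A"
  shows "(\<forall>i < n. \<forall>j < n.
            det X dvd (adj_mat X * A * transpose_mat (adj_mat X)) $$ (i, j)) \<and>
         (right_divisible_mat n (adj_mat X * A) (transpose_mat X) \<and>
          left_divisible_mat n (A * adj_mat X) (transpose_mat X)) \<and>
         (invertible_mat A \<longrightarrow>
            even n \<and>
            right_divisible_mat n (adj_mat X) (transpose_mat X * A) \<and>
            left_divisible_mat n (adj_mat X) (A * transpose_mat X))"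
proof (intro conjI allI impI)
  note X = assms(2) and A = assms(3) and alt = assms(4)
  have Xt: "transpose_mat X \<in> carrier_mat n n" and adj: "adj_mat X \<in> carrier_mat n n"
    using X adj_mat(1)[OF X] by auto
  obtain Y where Y: "Y \<in> carrier_mat n n" and AY: "adj_mat X * A = Y * transpose_mat X"
    using adj_mult_alternating_factor[OF X A alt] by blast
  show "right_divisible_mat n (adj_mat X * A) (transpose_mat X)"
    unfolding right_divisible_mat_def using adj A Xt Y AY by auto
  show "left_divisible_mat n (A * adj_mat X) (transpose_mat X)"
    unfolding left_divisible_mat_def
    using adj A Xt alternating_mult_adj_factor[OF X A alt] by auto
  have "adj_mat X * A * transpose_mat (adj_mat X) =
      Y * (transpose_mat X * adj_mat (transpose_mat X))"
    unfolding AY adj_mat_transpose[OF X] using adj Xt Y by (intro assoc_mult_mat) auto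
  also have "\<dots> = det X \<cdot>\<^sub>m Y"
    using Y by (simp add: adj_mat(2)[OF Xt] det_transpose[OF X] mult_smult_distrib[OF Y one_carrier_mat])
  finally show "det X dvd (adj_mat X * A * transpose_mat (adj_mat X)) $$ (i, j)"
    if "i < n" "j < n" for i j
    using Y that by simp
  assume "invertible_mat A"
  then obtain B where AB: "A * B = 1\<^sub>m n" and BA: "B * A = 1\<^sub>m (dim_row B)"
    using A by (auto simp: invertible_mat_def inverts_mat_def)
  then have B: "B \<in> carrier_mat n n"
    using A by (metis carrier_matD(2) carrier_matI index_mult_mat(2,3) index_one_mat(2,3))
  have BA: "B * A = 1\<^sub>m n"
    using BA B by simp
  show "even n"
    by (rule invertible_alternating_even_dim[OF A B alt AB])
  have altB: "alternating_mat B"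
    by (rule alternating_mat_inverse[OF A B alt AB])
  obtain U where U: "U \<in> carrier_mat n n" and "adj_mat X * B = U * transpose_mat X"
    using adj_mult_alternating_factor[OF X B altB] by blast
  then have "adj_mat X * B * A = U * transpose_mat X * A"
    by simp
  then have "adj_mat X = U * (transpose_mat X * A)"
    using adj by (simp add: assoc_mult_mat[OF adj B A] assoc_mult_mat[OF U Xt A] BA)
  then show "right_divisible_mat n (adj_mat X) (transpose_mat X * A)"
    unfolding right_divisible_mat_def
    using adj A Xt U by (intro conjI bexI[of _ U] mult_carrier_mat[of _ n n])
  obtain V where V: "V \<in> carrier_mat n n" and "B * adj_mat X = transpose_mat X * V"
    using alternating_mult_adj_factor[OF X B altB] by blast
  then have "A * (B * adj_mat X) = A * (transpose_mat X * V)"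
    by simp
  then have "adj_mat X = A * transpose_mat X * V"
    using adj by (simp add: assoc_mult_mat[OF A B adj, symmetric] assoc_mult_mat[OF A Xt V] AB)
  then show "left_divisible_mat n (adj_mat X) (A * transpose_mat X)"
    unfolding left_divisible_mat_def
    using adj A Xt V by (intro conjI bexI[of _ V] mult_carrier_mat[of _ n n])
qed

end
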